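(* Let $\tilde{i} : \mathbb{R}^d \times \mathbb{R}^d \times [0,\infty) \to \mathbb{R}^d$ be a consistent approximation of $i$, let $\bar{i}$ be an arbitrary discrete gradient of $I$, and let $\tilde{f} : \mathbb{R}^d \times \mathbb{R}^d \times [0,\infty) \to \mathbb{R}^d$ be a consistent approximation of $f$. Let $x \in \mathbb{R}^d$ and $h \in [0,\infty)$ be given and consider the following three problems. (a) Find $x' \in \mathbb{R}^d$ and $\lambda \in \mathbb{R}$ such that $x' = x + h \tilde{f}(x,x',h) + \lambda\, \tilde{i}(x,x',h)$ and $I(x') = I(x)$. (b) Find $x' \in \mathbb{R}^d$ such that $x' = x + h P(x,x',h) \tilde{f}(x,x',h)$, where $$P(x,x',h) = \mathrm{Id} - \frac{\tilde{i}(x,x',h)\, \bar{i}(x,x')^T}{\tilde{i}(x,x',h)^T \bar{i}(x,x')}.$$ (c) Find $x' \in \mathbb{R}^d$ such that $x' = x + h \widetilde{S}(x,x',h)\, \bar{i}(x,x')$, where $$\widetilde{S}(x,x',h) = \frac{\tilde{f}(x,x',h)\, \tilde{i}(x,x',h)^T - \tilde{i}(x,x',h)\, \tilde{f}(x,x',h)^T}{\tilde{i}(x,x',h) \cdot \bar{i}(x,x')}.$$ Assume that each of the three problems has a uniquely defined solution ($(x',\lambda)$ in (a), $x'$ in (b) and (c)), and that $\tilde{i}(x,x',h) \cdot \bar{i}(x,x') \neq 0$ at the solutions $x'$. Then (a), (b) and (c) define the same method, i.e. they yield the same $x'$.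
   Context: Setting: $d \in \mathbb{N}$; $f : \mathbb{R}^d \to \mathbb{R}^d$ is locally Lipschitz continuous; the ODE $\dot{x} = f(x)$ has a first integral $I : \mathbb{R}^d \to \mathbb{R}$ ($I$ is constant along solutions); $I$ is a Morse function (smooth with non-degenerate critical points); $i := \nabla I$ is locally Lipschitz continuous. A discrete gradient of $I$ is a continuous map $\bar{i} : \mathbb{R}^d \times \mathbb{R}^d \to \mathbb{R}^d$ with $\bar{i}(x,x') \cdot (x'-x) = I(x') - I(x)$ and $\bar{i}(x,x) = i(x)$ for all $x,x' \in \mathbb{R}^d$. For $\varphi : \mathbb{R}^d \to \mathbb{R}^d$, a map $\tilde{\varphi} : \mathbb{R}^d \times \mathbb{R}^d \times [0,\infty) \to \mathbb{R}^d$ is a consistent approximation of $\varphi$ if $\tilde{\varphi}(x,x,0) = \varphi(x)$ for all $x \in \mathbb{R}^d$. $\mathrm{Id}$ is the $d \times d$ identity matrix; vectors are columns. *)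

theory Defs
  imports "HOL-Analysis.Analysis"
begin

section \<open>Morse functions\<close>

definition partial :: "'n::finite \<Rightarrow> (real ^ 'n \<Rightarrow> real) \<Rightarrow> real ^ 'n \<Rightarrow> real" where
  "partial j g x = frechet_derivative g (at x) (axis j 1)"

text \<open>
  Being \<open>k\<close> times continuously differentiable on the whole space. Continuity of the partial
  derivatives of order below \<open>k\<close> follows from their differentiability; the case \<open>0\<close> enforces
  continuity of those of order \<open>k\<close>. Frechet differentiability at each step ensures that
  \<open>partial\<close> is never applied to a non-differentiable function.
\<close>
fun Ck :: "nat \<Rightarrow> (real ^ 'n::finite \<Rightarrow> real) \<Rightarrow> bool" where
  "Ck 0 g \<longleftrightarrow> continuous_on UNIV g"
| "Ck (Suc k) g \<longleftrightarrow> (\<forall>x. g differentiable (at x)) \<and> (\<forall>j. Ck k (partial j g))"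

definition smooth :: "(real ^ 'n::finite \<Rightarrow> real) \<Rightarrow> bool" where
  "smooth g \<longleftrightarrow> (\<forall>k. Ck k g)"

definition hessian :: "(real ^ 'n::finite \<Rightarrow> real) \<Rightarrow> real ^ 'n \<Rightarrow> real ^ 'n ^ 'n" where
  "hessian g x = (\<chi> j k. partial j (partial k g) x)"

definition morse_function :: "(real ^ 'n::finite \<Rightarrow> real) \<Rightarrow> bool" where
  "morse_function g \<longleftrightarrow>
     smooth g \<and> (\<forall>x. GDERIV g x :> 0 \<longrightarrow> det (hessian g x) \<noteq> 0)"

section \<open>First integrals, discrete gradients, consistent approximations\<close>

definition locally_lipschitz :: "(real ^ 'n::finite \<Rightarrow> real ^ 'n) \<Rightarrow> bool" where
  "locally_lipschitz f \<longleftrightarrow> local_lipschitz (UNIV :: real set) UNIV (\<lambda>_. f)"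

definition ode_solution_on ::
  "(real ^ 'n::finite \<Rightarrow> real ^ 'n) \<Rightarrow> real set \<Rightarrow> (real \<Rightarrow> real ^ 'n) \<Rightarrow> bool" where
  "ode_solution_on f J u \<longleftrightarrow>
     is_interval J \<and> (\<forall>t\<in>J. (u has_vector_derivative f (u t)) (at t within J))"

definition first_integral ::
  "(real ^ 'n::finite \<Rightarrow> real ^ 'n) \<Rightarrow> (real ^ 'n \<Rightarrow> real) \<Rightarrow> bool" where
  "first_integral f I \<longleftrightarrow>
     (\<forall>J u. ode_solution_on f J u \<longrightarrow> (\<lambda>t. I (u t)) constant_on J)"

definition discrete_gradient ::
  "(real ^ 'n::finite \<Rightarrow> real) \<Rightarrow> (real ^ 'n \<Rightarrow> real ^ 'n \<Rightarrow> real ^ 'n) \<Rightarrow> bool" where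
  "discrete_gradient I ib \<longleftrightarrow>
     continuous_on UNIV (\<lambda>(x, x'). ib x x') \<and>
     (\<forall>x x'. ib x x' \<bullet> (x' - x) = I x' - I x) \<and>
     (\<forall>x. GDERIV I x :> ib x x)"

text \<open>
  The step size ranges over \<open>[0, \<infinity>)\<close>; it is modelled by type \<^typ>\<open>real\<close>, and only values at
  nonnegative step sizes are ever used.
\<close>
definition consistent_approximation ::
  "(real ^ 'n::finite \<Rightarrow> real ^ 'n) \<Rightarrow> (real ^ 'n \<Rightarrow> real ^ 'n \<Rightarrow> real \<Rightarrow> real ^ 'n) \<Rightarrow> bool" where
  "consistent_approximation \<phi> \<phi>t \<longleftrightarrow> (\<forall>x. \<phi>t x x 0 = \<phi> x)"

section \<open>The three methods\<close>

definition outer_product :: "real ^ 'n::finite \<Rightarrow> real ^ 'n \<Rightarrow> real ^ 'n ^ 'n" where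
  "outer_product v w = columnvector v ** (rowvector w :: real ^ 'n ^ 1)"

definition P_matrix ::
  "(real ^ 'n::finite \<Rightarrow> real ^ 'n \<Rightarrow> real \<Rightarrow> real ^ 'n) \<Rightarrow> (real ^ 'n \<Rightarrow> real ^ 'n \<Rightarrow> real ^ 'n) \<Rightarrow>
   real ^ 'n \<Rightarrow> real ^ 'n \<Rightarrow> real \<Rightarrow> real ^ 'n ^ 'n" where
  "P_matrix it ib x x' h =
     mat 1 - outer_product (it x x' h) (ib x x') /\<^sub>R (it x x' h \<bullet> ib x x')"

definition S_matrix ::
  "(real ^ 'n::finite \<Rightarrow> real ^ 'n \<Rightarrow> real \<Rightarrow> real ^ 'n) \<Rightarrow>
   (real ^ 'n \<Rightarrow> real ^ 'n \<Rightarrow> real \<Rightarrow> real ^ 'n) \<Rightarrow> (real ^ 'n \<Rightarrow> real ^ 'n \<Rightarrow> real ^ 'n) \<Rightarrow>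
   real ^ 'n \<Rightarrow> real ^ 'n \<Rightarrow> real \<Rightarrow> real ^ 'n ^ 'n" where
  "S_matrix ft it ib x x' h =
     (outer_product (ft x x' h) (it x x' h) - outer_product (it x x' h) (ft x x' h))
       /\<^sub>R (it x x' h \<bullet> ib x x')"

definition solves_a ::
  "(real ^ 'n::finite \<Rightarrow> real) \<Rightarrow> (real ^ 'n \<Rightarrow> real ^ 'n \<Rightarrow> real \<Rightarrow> real ^ 'n) \<Rightarrow>
   (real ^ 'n \<Rightarrow> real ^ 'n \<Rightarrow> real \<Rightarrow> real ^ 'n) \<Rightarrow>
   real ^ 'n \<Rightarrow> real \<Rightarrow> real ^ 'n \<Rightarrow> real \<Rightarrow> bool" where
  "solves_a I ft it x h x' \<mu> \<longleftrightarrow>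
     x' = x + h *\<^sub>R ft x x' h + \<mu> *\<^sub>R it x x' h \<and> I x' = I x"

text \<open>
  Division by zero being \<open>0\<close> in HOL, the two equations below would acquire spurious solutions
  where the denominator vanishes; the first conjuncts say that \<open>P\<close> and \<open>S\<close> are defined at \<open>x'\<close>.
\<close>
definition solves_b ::
  "(real ^ 'n::finite \<Rightarrow> real ^ 'n \<Rightarrow> real \<Rightarrow> real ^ 'n) \<Rightarrow>
   (real ^ 'n \<Rightarrow> real ^ 'n \<Rightarrow> real \<Rightarrow> real ^ 'n) \<Rightarrow> (real ^ 'n \<Rightarrow> real ^ 'n \<Rightarrow> real ^ 'n) \<Rightarrow>
   real ^ 'n \<Rightarrow> real \<Rightarrow> real ^ 'n \<Rightarrow> bool" where
  "solves_b ft it ib x h x' \<longleftrightarrow>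
     it x x' h \<bullet> ib x x' \<noteq> 0 \<and>
     x' = x + h *\<^sub>R (P_matrix it ib x x' h *v ft x x' h)"

definition solves_c ::
  "(real ^ 'n::finite \<Rightarrow> real ^ 'n \<Rightarrow> real \<Rightarrow> real ^ 'n) \<Rightarrow>
   (real ^ 'n \<Rightarrow> real ^ 'n \<Rightarrow> real \<Rightarrow> real ^ 'n) \<Rightarrow> (real ^ 'n \<Rightarrow> real ^ 'n \<Rightarrow> real ^ 'n) \<Rightarrow>
   real ^ 'n \<Rightarrow> real \<Rightarrow> real ^ 'n \<Rightarrow> bool" where
  "solves_c ft it ib x h x' \<longleftrightarrow>
     it x x' h \<bullet> ib x x' \<noteq> 0 \<and>
     x' = x + h *\<^sub>R (S_matrix ft it ib x x' h *v ib x x')"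

end

(*
  Where it . ib is nonzero, both P ft and S ib equal ft - ((ib . ft) / (it . ib)) it, so (b) and (c)
  are the same equation. It has the form of (a) with the multiplier -h (ib . ft) / (it . ib), and
  this is precisely the multiplier that I x' = I x, i.e. ib . (x' - x) = 0, forces.
*)
theory Submission
  imports Defs
begin

lemma outer_product_vector_mult: "outer_product v w *v u = (w \<bullet> u) *\<^sub>R v"
  by (simp add: vec_eq_iff outer_product_def columnvector_def rowvector_def matrix_matrix_mult_def
      matrix_vector_mult_def inner_vec_def sum_distrib_left sum_distrib_right mult_ac)

text \<open>Also true when the denominator vanishes: both sides then reduce to \<open>v\<close>,
  since inverse and quotient are \<open>0\<close> there.\<close>

lemma P_matrix_vector_mult:
  "P_matrix it ib x x' h *v v = v - ((ib x x' \<bullet> v) / (it x x' h \<bullet> ib x x')) *\<^sub>R it x x' h"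
  by (simp add: P_matrix_def matrix_vector_mult_diff_rdistrib scaleR_matrix_vector_assoc [symmetric]
      outer_product_vector_mult divide_inverse mult.commute)

text \<open>Applied to \<open>ib\<close>, the first outer product gives
  \<open>(it \<bullet> ib)\<close> times \<open>ft\<close>; the nonzero denominator cancels this
  factor, leaving \<open>ft\<close> with coefficient 1. The second gives the correction along
  \<open>it\<close>.\<close>

lemma S_matrix_vector_mult:
  assumes "it x x' h \<bullet> ib x x' \<noteq> 0"
  shows "S_matrix ft it ib x x' h *v ib x x' = P_matrix it ib x x' h *v ft x x' h"
  using assms
  by (simp add: S_matrix_def P_matrix_vector_mult matrix_vector_mult_diff_rdistrib
      scaleR_matrix_vector_assoc [symmetric] outer_product_vector_mult scaleR_diff_right
      divide_inverse inner_commute mult.commute)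

text \<open>The nonvanishing conjunct in both definitions supplies the hypothesis under which the
  two right-hand sides agree.\<close>

lemma solves_c_iff_solves_b: "solves_c ft it ib x h x' \<longleftrightarrow> solves_b ft it ib x h x'"
  by (auto simp: solves_b_def solves_c_def S_matrix_vector_mult)

lemma solves_b_iff_ex_solves_a:
  assumes "discrete_gradient I ib" and nz: "it x x' h \<bullet> ib x x' \<noteq> 0"
  shows "solves_b ft it ib x h x' \<longleftrightarrow> (\<exists>\<mu>. solves_a I ft it x h x' \<mu>)"
proof -
  \<comment> \<open>The coefficient of \<open>it\<close> when \<open>h *\<^sub>R (P ft)\<close> is
    expanded.\<close>
  let ?c = "- h * (ib x x' \<bullet> ft x x' h) / (it x x' h \<bullet> ib x x')"
  have dg: "ib x x' \<bullet> (x' - x) = I x' - I x"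
    using assms(1) by (simp add: discrete_gradient_def)
  have b: "solves_b ft it ib x h x' \<longleftrightarrow> x' = x + h *\<^sub>R ft x x' h + ?c *\<^sub>R it x x' h"
    using nz by (simp add: solves_b_def P_matrix_vector_mult scaleR_diff_right algebra_simps)
  \<comment> \<open>Pairing the increment with \<open>ib\<close> makes conservation of
    \<open>I\<close> an affine equation in \<open>\<mu>\<close> with nonzero slope
    \<open>it \<bullet> ib\<close>; its only root is \<open>?c\<close>.\<close>
  have energy: "I x' = I x \<longleftrightarrow> \<mu> = ?c" if "x' = x + h *\<^sub>R ft x x' h + \<mu> *\<^sub>R it x x' h" for \<mu>
  proof -
    have "x' - x = h *\<^sub>R ft x x' h + \<mu> *\<^sub>R it x x' h"
      using that by (metis add.assoc add_diff_cancel_left')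
    then have "I x' - I x = h * (ib x x' \<bullet> ft x x' h) + \<mu> * (it x x' h \<bullet> ib x x')"
      using dg by (simp add: inner_add_right inner_commute)
    then show ?thesis
      using nz by (auto simp: field_simps)
  qed
  show ?thesis
    unfolding b solves_a_def using energy by metis
qed

theorem theorem2:
  fixes f i :: "real ^ 'n::finite \<Rightarrow> real ^ 'n"
    and I :: "real ^ 'n \<Rightarrow> real"
    and ft it :: "real ^ 'n \<Rightarrow> real ^ 'n \<Rightarrow> real \<Rightarrow> real ^ 'n"
    and ib :: "real ^ 'n \<Rightarrow> real ^ 'n \<Rightarrow> real ^ 'n"
    and x :: "real ^ 'n" and h :: real
  assumes "locally_lipschitz f"
    and "first_integral f I"
    and "morse_function I"
    and "\<And>y. GDERIV I y :> i y"
    and "locally_lipschitz i"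
    and "consistent_approximation i it"
    and "discrete_gradient I ib"
    and "consistent_approximation f ft"
    and "h \<ge> 0"
    and "\<exists>!(p :: (real ^ 'n) \<times> real). solves_a I ft it x h (fst p) (snd p)"
    and "\<exists>!x'. solves_b ft it ib x h x'"
    and "\<exists>!x'. solves_c ft it ib x h x'"
    and "\<And>x'. (\<exists>\<mu>. solves_a I ft it x h x' \<mu>) \<or> solves_b ft it ib x h x' \<or> solves_c ft it ib x h x'
           \<Longrightarrow> it x x' h \<bullet> ib x x' \<noteq> 0"
  shows "\<exists>x'. {y. \<exists>\<mu>. solves_a I ft it x h y \<mu>} = {x'} \<and>
              {y. solves_b ft it ib x h y} = {x'} \<and>
              {y. solves_c ft it ib x h y} = {x'}"
proof -
  \<comment> \<open>Either side makes \<open>y\<close> a solution, so the denominator is nonzero at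
    \<open>y\<close>; where it vanishes, both sides are false.\<close>
  have ab: "(\<exists>\<mu>. solves_a I ft it x h y \<mu>) \<longleftrightarrow> solves_b ft it ib x h y" for y
    using solves_b_iff_ex_solves_a [OF assms(7)] assms(13) by blast
  \<comment> \<open>The three solution sets coincide, so the singleton found for (b) serves for
    all.\<close>
  obtain x' where "{y. solves_b ft it ib x h y} = {x'}"
    using assms(11) by auto
  then show ?thesis
    by (simp add: ab solves_c_iff_solves_b)
qed

end
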